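(* Let $q$ be a prime power, let $n,m\ge 2$ be integers and let $i\in\{1,\dots,n\}$. The lattice $\mathscr{L}_i(n,m;q)$ is supersolvable if and only if $i\in\{1,n-1,n\}$ or $m\in\{2,\dots,i\}$.
   Context: $\mathbb{F}_{q^m}$ denotes the extension of degree $m$ of the finite field $\mathbb{F}_q$. The rank $\mathrm{rk}(v)$ of a vector $v\in\mathbb{F}_{q^m}^n$ is the $\mathbb{F}_q$-dimension of the $\mathbb{F}_q$-linear span of its entries. Let $T_i(n,m;q)=\{v\in\mathbb{F}_{q^m}^n:\mathrm{rk}(v)\le i\}$. The rank-metric lattice $\mathscr{L}_i(n,m;q)$ is the set of all $\mathbb{F}_{q^m}$-linear subspaces of $\mathbb{F}_{q^m}^n$ spanned by elements of $T_i(n,m;q)$ (this includes $\{0\}$), partially ordered by inclusion; it is a geometric lattice with rank function $\dim_{\mathbb{F}_{q^m}}$, join $X+Y$ and meet the span of the vectors of rank at most $i$ in $X\cap Y$. An element $X$ of a graded lattice with rank function $\rho$ is modular if $\rho(X\wedge Y)+\rho(X\vee Y)=\rho(X)+\rho(Y)$ for all $Y$ in the lattice. A geometric lattice is supersolvable if it has a maximal chain consisting of modular elements. *)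

theory Defs
  imports "HOL-Analysis.Cartesian_Space" "HOL-Algebra.Lattice"
begin

section \<open>Modular elements and supersolvability\<close>

definition covered_by :: "('b, 'c) gorder_scheme \<Rightarrow> 'b \<Rightarrow> 'b \<Rightarrow> bool" where
  "covered_by L x y \<longleftrightarrow> x \<in> carrier L \<and> y \<in> carrier L \<and> x \<sqsubset>\<^bsub>L\<^esub> y
     \<and> \<not> (\<exists>z\<in>carrier L. x \<sqsubset>\<^bsub>L\<^esub> z \<and> z \<sqsubset>\<^bsub>L\<^esub> y)"

definition rank_function :: "('b, 'c) gorder_scheme \<Rightarrow> ('b \<Rightarrow> nat) \<Rightarrow> bool" where
  "rank_function L \<rho> \<longleftrightarrow> (\<forall>x. least L x (carrier L) \<longrightarrow> \<rho> x = 0)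
     \<and> (\<forall>x y. covered_by L x y \<longrightarrow> \<rho> y = Suc (\<rho> x))"

definition modular_element :: "('b, 'c) gorder_scheme \<Rightarrow> ('b \<Rightarrow> nat) \<Rightarrow> 'b \<Rightarrow> bool" where
  "modular_element L \<rho> x \<longleftrightarrow> x \<in> carrier L
     \<and> (\<forall>y\<in>carrier L. \<rho> (x \<sqinter>\<^bsub>L\<^esub> y) + \<rho> (x \<squnion>\<^bsub>L\<^esub> y) = \<rho> x + \<rho> y)"

text \<open>Intended for a geometric lattice \<open>L\<close> with rank function \<open>\<rho>\<close>.\<close>
definition supersolvable :: "('b, 'c) gorder_scheme \<Rightarrow> ('b \<Rightarrow> nat) \<Rightarrow> bool" where
  "supersolvable L \<rho> \<longleftrightarrow>
     (\<exists>C. pred_on.maxchain (carrier L) (lless L) C \<and> (\<forall>x\<in>C. modular_element L \<rho> x))"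


section \<open>Rank-metric lattices\<close>

text \<open>
  The extension of finite fields is given by a field homomorphism \<open>\<iota>\<close> from the small field
  \<open>'k\<close> to the big field \<open>'a\<close>; it makes \<open>'a\<close> a vector space over \<open>'k\<close>.
\<close>

definition field_embedding :: "('k::field \<Rightarrow> 'a::field) \<Rightarrow> bool" where
  "field_embedding \<iota> \<longleftrightarrow> \<iota> 1 = 1 \<and> (\<forall>x y. \<iota> (x + y) = \<iota> x + \<iota> y) \<and> (\<forall>x y. \<iota> (x * y) = \<iota> x * \<iota> y)"

definition ext_scale :: "('k::field \<Rightarrow> 'a::field) \<Rightarrow> 'k \<Rightarrow> 'a \<Rightarrow> 'a" where
  "ext_scale \<iota> c x = \<iota> c * x"

lemma vector_space_ext_scale:
  assumes "field_embedding \<iota>"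
  shows "vector_space (ext_scale \<iota>)"
  using assms by unfold_locales (auto simp: field_embedding_def ext_scale_def algebra_simps)

definition rk :: "('k::field \<Rightarrow> 'a::field) \<Rightarrow> 'a ^ 'n \<Rightarrow> nat" where
  "rk \<iota> v = vector_space.dim (ext_scale \<iota>) (module.span (ext_scale \<iota>) (range (($) v)))"

definition rank_ball :: "('k::field \<Rightarrow> 'a::field) \<Rightarrow> nat \<Rightarrow> ('a ^ 'n) set" where
  "rank_ball \<iota> i = {v. rk \<iota> v \<le> i}"

definition rank_metric_lattice :: "('k::field \<Rightarrow> 'a::field) \<Rightarrow> nat \<Rightarrow> ('a ^ 'n) set gorder" where
  "rank_metric_lattice \<iota> i =
     \<lparr>carrier = {vec.span S |S. S \<subseteq> rank_ball \<iota> i}, eq = (=), le = (\<subseteq>)\<rparr>"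


section \<open>The lattice operations and the rank function\<close>

lemma carrier_rank_metric_lattice:
  "X \<in> carrier (rank_metric_lattice \<iota> i) \<longleftrightarrow> X = vec.span (X \<inter> rank_ball \<iota> i)"
proof
  assume "X \<in> carrier (rank_metric_lattice \<iota> i)"
  then obtain S where S: "X = vec.span S" "S \<subseteq> rank_ball \<iota> i"
    by (auto simp: rank_metric_lattice_def)
  have "vec.span S \<subseteq> vec.span (X \<inter> rank_ball \<iota> i)"
    using S vec.span_superset by (intro vec.span_mono) blast
  moreover have "vec.span (X \<inter> rank_ball \<iota> i) \<subseteq> X"
    unfolding S by (rule vec.span_minimal) auto
  ultimately show "X = vec.span (X \<inter> rank_ball \<iota> i)" using S by blast
qed (auto simp: rank_metric_lattice_def)

lemma rank_metric_lattice_sel [simp]: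
  "x .=\<^bsub>rank_metric_lattice \<iota> i\<^esub> y \<longleftrightarrow> x = y"
  "x \<sqsubseteq>\<^bsub>rank_metric_lattice \<iota> i\<^esub> y \<longleftrightarrow> x \<subseteq> y"
  "x \<sqsubset>\<^bsub>rank_metric_lattice \<iota> i\<^esub> y \<longleftrightarrow> x \<subset> y"
  by (auto simp: rank_metric_lattice_def lless_def)

lemma span_in_rank_metric_lattice:
  "S \<subseteq> rank_ball \<iota> i \<Longrightarrow> vec.span S \<in> carrier (rank_metric_lattice \<iota> i)"
  by (auto simp: rank_metric_lattice_def)

lemma subspace_rank_metric_lattice:
  "X \<in> carrier (rank_metric_lattice \<iota> i) \<Longrightarrow> vec.subspace X"
  by (auto simp: rank_metric_lattice_def)

lemma least_upper_rank_metric_lattice: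
  assumes "X \<in> carrier (rank_metric_lattice \<iota> i)" "Y \<in> carrier (rank_metric_lattice \<iota> i)"
  shows "least (rank_metric_lattice \<iota> i) {x + y |x y. x \<in> X \<and> y \<in> Y}
           (Upper (rank_metric_lattice \<iota> i) {X, Y})"
proof -
  let ?B = "rank_ball \<iota> i"
  let ?Z = "{x + y |x y. x \<in> X \<and> y \<in> Y}"
  have X: "X = vec.span (X \<inter> ?B)" and Y: "Y = vec.span (Y \<inter> ?B)"
    using assms by (simp_all flip: carrier_rank_metric_lattice)
  have sX: "vec.subspace X" and sY: "vec.subspace Y"
    using assms by (auto intro: subspace_rank_metric_lattice)
  have "vec.span ((X \<inter> ?B) \<union> (Y \<inter> ?B)) = ?Z"
    unfolding vec.span_Un X[symmetric] Y[symmetric] by blast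
  moreover have "vec.span ((X \<inter> ?B) \<union> (Y \<inter> ?B)) \<in> carrier (rank_metric_lattice \<iota> i)"
    by (rule span_in_rank_metric_lattice) auto
  ultimately have Z: "?Z \<in> carrier (rank_metric_lattice \<iota> i)" by simp
  have "X \<subseteq> ?Z"
  proof
    fix x assume "x \<in> X"
    moreover have "x = x + 0" by simp
    ultimately show "x \<in> ?Z" using vec.subspace_0[OF sY] by blast
  qed
  moreover have "Y \<subseteq> ?Z"
  proof
    fix y assume "y \<in> Y"
    moreover have "y = 0 + y" by simp
    ultimately show "y \<in> ?Z" using vec.subspace_0[OF sX] by blast
  qed
  moreover have "?Z \<subseteq> W" if "W \<in> carrier (rank_metric_lattice \<iota> i)" "X \<subseteq> W" "Y \<subseteq> W" for W
    using that subspace_rank_metric_lattice[OF that(1)] vec.subspace_add by blast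
  ultimately show ?thesis
    using Z assms by (simp add: least_def Upper_def)
qed

lemma greatest_lower_rank_metric_lattice:
  assumes "X \<in> carrier (rank_metric_lattice \<iota> i)" "Y \<in> carrier (rank_metric_lattice \<iota> i)"
  shows "greatest (rank_metric_lattice \<iota> i) (vec.span (X \<inter> Y \<inter> rank_ball \<iota> i))
           (Lower (rank_metric_lattice \<iota> i) {X, Y})"
proof -
  let ?B = "rank_ball \<iota> i"
  let ?Z = "vec.span (X \<inter> Y \<inter> ?B)"
  have sX: "vec.subspace X" and sY: "vec.subspace Y"
    using assms by (auto intro: subspace_rank_metric_lattice)
  have "?Z \<subseteq> X" "?Z \<subseteq> Y"
    by (rule vec.span_minimal[OF _ sX], blast, rule vec.span_minimal[OF _ sY], blast)
  moreover have "?Z \<in> carrier (rank_metric_lattice \<iota> i)"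
    by (rule span_in_rank_metric_lattice) auto
  moreover have "W \<subseteq> ?Z" if "W \<in> carrier (rank_metric_lattice \<iota> i)" "W \<subseteq> X" "W \<subseteq> Y" for W
  proof -
    have "W = vec.span (W \<inter> ?B)" using that(1) by (simp only: carrier_rank_metric_lattice[symmetric])
    also have "\<dots> \<subseteq> ?Z" using that by (intro vec.span_mono) blast
    finally show ?thesis .
  qed
  ultimately show ?thesis
    using assms by (simp add: greatest_def Lower_def)
qed

lemma lattice_rank_metric_lattice: "lattice (rank_metric_lattice \<iota> i)"
proof
  show "(.=\<^bsub>rank_metric_lattice \<iota> i\<^esub>) = (=)" by (simp add: rank_metric_lattice_def)
qed (auto intro: least_upper_rank_metric_lattice greatest_lower_rank_metric_lattice)

lemma join_rank_metric_lattice: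
  assumes "X \<in> carrier (rank_metric_lattice \<iota> i)" "Y \<in> carrier (rank_metric_lattice \<iota> i)"
  shows "X \<squnion>\<^bsub>rank_metric_lattice \<iota> i\<^esub> Y = {x + y |x y. x \<in> X \<and> y \<in> Y}"
proof -
  interpret lattice "rank_metric_lattice \<iota> i" by (rule lattice_rank_metric_lattice)
  show ?thesis
    unfolding join_def sup_def
    by (rule some_equality, rule least_upper_rank_metric_lattice[OF assms],
        erule least_unique, rule least_upper_rank_metric_lattice[OF assms])
qed

lemma meet_rank_metric_lattice:
  assumes "X \<in> carrier (rank_metric_lattice \<iota> i)" "Y \<in> carrier (rank_metric_lattice \<iota> i)"
  shows "X \<sqinter>\<^bsub>rank_metric_lattice \<iota> i\<^esub> Y = vec.span (X \<inter> Y \<inter> rank_ball \<iota> i)"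
proof -
  interpret lattice "rank_metric_lattice \<iota> i" by (rule lattice_rank_metric_lattice)
  show ?thesis
    unfolding meet_def inf_def
    by (rule some_equality, rule greatest_lower_rank_metric_lattice[OF assms],
        erule greatest_unique, rule greatest_lower_rank_metric_lattice[OF assms])
qed

lemma rank_function_dim: "rank_function (rank_metric_lattice \<iota> i) vec.dim"
  unfolding rank_function_def
proof safe
  fix X assume "least (rank_metric_lattice \<iota> i) X (carrier (rank_metric_lattice \<iota> i))"
  moreover have "vec.span {} \<in> carrier (rank_metric_lattice \<iota> i)"
    by (rule span_in_rank_metric_lattice) auto
  ultimately have "X \<subseteq> {0}" by (auto simp: least_def)
  then show "vec.dim X = 0" by simp
next
  fix X Y assume cov: "covered_by (rank_metric_lattice \<iota> i) X Y"
  let ?B = "rank_ball \<iota> i"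
  have X: "X = vec.span (X \<inter> ?B)" and Y: "Y = vec.span (Y \<inter> ?B)"
    using cov by (simp_all only: covered_by_def carrier_rank_metric_lattice[symmetric])
  have "X \<subset> Y" using cov by (simp add: covered_by_def)
  then have "\<not> Y \<inter> ?B \<subseteq> X"
    using Y vec.span_minimal[of "Y \<inter> ?B" X] vec.subspace_span[of "X \<inter> ?B", folded X] by blast
  then obtain v where v: "v \<in> Y" "v \<in> ?B" "v \<notin> X" by blast
  define Z where "Z = vec.span (insert v (X \<inter> ?B))"
  have Z: "Z \<in> carrier (rank_metric_lattice \<iota> i)"
    unfolding Z_def using v by (intro span_in_rank_metric_lattice) auto
  have "X \<subset> Z"
    using X v(3) vec.span_mono[of "X \<inter> ?B" "insert v (X \<inter> ?B)"] vec.span_base[of v "insert v (X \<inter> ?B)"]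
    unfolding Z_def by blast
  moreover have "Z \<subseteq> Y"
    unfolding Z_def using v \<open>X \<subset> Y\<close> vec.subspace_span[of "Y \<inter> ?B", folded Y]
    by (intro vec.span_minimal) auto
  ultimately have "Z = Y" using cov Z by (auto simp: covered_by_def)
  then have "vec.dim Y = vec.dim (insert v (X \<inter> ?B))" by (auto simp: Z_def)
  also have "\<dots> = Suc (vec.dim (X \<inter> ?B))" using v(3) unfolding vec.dim_insert X[symmetric] by simp
  also have "vec.dim (X \<inter> ?B) = vec.dim X" using vec.dim_span[of "X \<inter> ?B"] unfolding X[symmetric] by simp
  finally show "vec.dim Y = Suc (vec.dim X)" .
qed

end

theory Submission
  imports Defs
begin

text \<open>
  A lattice element \<open>X\<close> is modular as soon as every intersection \<open>X \<inter> Y\<close> with a lattice element is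
  again spanned by vectors of rank at most \<open>i\<close>. This holds for all \<open>X\<close> if \<open>i = n\<close> or \<open>i \<ge> m\<close>, since
  then every vector has rank at most \<open>i\<close>, and if \<open>i = 1\<close>, since intersections of subspaces defined
  over the small field are defined over it. If \<open>i = n - 1\<close>, it holds for everything inside a
  coordinate hyperplane, and hence for a maximal chain through that hyperplane.

  If \<open>2 \<le> i \<le> n - 2\<close> and \<open>i < m\<close>, no coatom \<open>H\<close> is modular, whereas every maximal chain contains a
  coatom: there are \<open>u \<notin> H\<close> and \<open>v\<close> of rank at most \<open>i\<close> such that \<open>u + v \<in> H\<close> has rank \<open>i + 1\<close>, so
  that the line spanned by \<open>u\<close> and \<open>v\<close> meets \<open>H\<close> trivially in the lattice.
\<close>

section \<open>Equations of hyperplanes and generalities on chains\<close>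

lemma sum_support:
  fixes f :: "'n::finite \<Rightarrow> 'a::comm_monoid_add"
  assumes "\<And>j. j \<notin> J \<Longrightarrow> f j = 0"
  shows "sum f UNIV = sum f J"
  using assms by (intro sum.mono_neutral_right) auto

text \<open>Some standard basis vector \<open>axis k 1\<close> lies outside \<open>H\<close> and so
  spans a complement of it; \<open>a j\<close> is the component of \<open>axis j 1\<close> along
  \<open>axis k 1\<close> modulo \<open>H\<close>. The normalisation \<open>a k = 1\<close> later
  allows entry \<open>k\<close> of a vector to be used to adjust the value of the linear
  form.\<close>

lemma hyperplane_equation:
  fixes H :: "('a::field ^ 'n::finite) set"
  assumes sH: "vec.subspace H" and dimH: "Suc (vec.dim H) = CARD('n)"
  obtains k a where "a k = 1" "\<And>x. x \<in> H \<longleftrightarrow> (\<Sum>j\<in>UNIV. x $ j * a j) = 0"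
proof -
  have "\<not> cart_basis \<subseteq> H"
  proof
    assume "cart_basis \<subseteq> H"
    then have "H = UNIV" using vec.span_minimal[OF _ sH] span_cart_basis by blast
    then show False using dimH vec_dim_card[where 'a='a and 'n='n] by simp
  qed
  then obtain k where k: "axis k 1 \<notin> H" by (auto simp: cart_basis_def)
  have "vec.dim (insert (axis k 1) H) = CARD('n)"
    unfolding vec.dim_insert vec.span_eq_iff[THEN iffD2, OF sH] using k dimH by simp
  then have "vec.span (insert (axis k 1) H) = UNIV"
    using vec.dim_eq_full vec_dim_card by (metis vec.dimension_def vec.dim_UNIV)
  then have "\<exists>c. axis j 1 - c *s axis k 1 \<in> H" for j
    using vec.span_breakdown_eq[of "axis j 1" "axis k 1" H] sH vec.span_eq_iff by (metis UNIV_I)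
  then obtain a where a: "\<And>j. axis j 1 - a j *s axis k 1 \<in> H" by metis
  have 0: "c = 0" if "c *s axis k 1 \<in> H" for c
  proof (rule ccontr)
    assume "c \<noteq> 0"
    then have "axis k 1 = (1 / c) *s (c *s axis k 1 :: 'a ^ 'n)" by (simp add: vector_smult_assoc)
    then show False using k that vec.subspace_scale[OF sH] by metis
  qed
  have "(1 - a k) *s axis k 1 \<in> H" using a[of k] by (simp add: vec.scale_left_diff_distrib)
  then have "a k = 1" using 0 by fastforce
  moreover have "x \<in> H \<longleftrightarrow> (\<Sum>j\<in>UNIV. x $ j * a j) = 0" for x
  proof -
    let ?s = "\<Sum>j\<in>UNIV. x $ j * a j"
    \<comment> \<open>Expanding \<open>x\<close> in the standard basis shows that \<open>x\<close>
      is congruent to \<open>?s *s axis k 1\<close> modulo \<open>H\<close>.\<close>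
    have "(\<Sum>j\<in>UNIV. x $ j *s (axis j 1 - a j *s axis k 1)) \<in> H"
      using a sH by (intro vec.subspace_sum vec.subspace_scale)
    moreover have "(\<Sum>j\<in>UNIV. x $ j *s (axis j 1 - a j *s axis k 1)) = x - ?s *s axis k 1"
      using basis_expansion[of x]
      by (simp add: vec.scale_right_diff_distrib sum_subtractf vec.scale_sum_left vector_smult_assoc)
    ultimately have *: "x - ?s *s axis k 1 \<in> H" by simp
    show ?thesis
    proof
      assume "x \<in> H"
      then have "?s *s axis k 1 \<in> H" using vec.subspace_diff[OF sH _ *, of x] by simp
      then show "?s = 0" by (rule 0)
    qed (use * in simp)
  qed
  ultimately show ?thesis using that by blast
qed

text \<open>The Hausdorff maximal principle supplies some maximal chain, and any one will
  do.\<close>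

lemma supersolvable_if_all_modular:
  assumes "\<And>X. X \<in> carrier L \<Longrightarrow> modular_element L \<rho> X"
  shows "supersolvable L \<rho>"
  unfolding supersolvable_def
  using pred_on.Hausdorff[of "carrier L" "lless L"] assms
  by (meson pred_on.chain_def pred_on.maxchain_def subsetD)

lemma chain_rank_metric_lattice:
  "pred_on.chain A (lless (rank_metric_lattice \<iota> i)) C \<longleftrightarrow> C \<subseteq> A \<and> (\<forall>X\<in>C. \<forall>Y\<in>C. X \<subseteq> Y \<or> Y \<subseteq> X)"
  by (simp add: pred_on.chain_def subset_iff_psubset_eq)

section \<open>The big field as a vector space over the small one, and ranks of vectors\<close>

locale finite_field_extension =
  fixes \<iota> :: "'k::{field, finite} \<Rightarrow> 'a::{field, finite}"
  assumes embedding: "field_embedding \<iota>"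
begin

sublocale K: vector_space "ext_scale \<iota>"
  using embedding by (rule vector_space_ext_scale)

text \<open>A basis is fixed once and for all, so that \<open>card ext_basis\<close> can stand for
  the degree \<open>m\<close> of the extension.\<close>

definition ext_basis :: "'a set" where
  "ext_basis = (SOME B. K.independent B \<and> K.span B = UNIV)"

lemma ext_basis: "K.independent ext_basis \<and> K.span ext_basis = UNIV"
proof -
  obtain B :: "'a set" where "K.independent B" "UNIV \<subseteq> K.span B"
    using K.basis_exists[of UNIV] by metis
  then have "\<exists>B. K.independent B \<and> K.span B = UNIV" by auto
  then show ?thesis unfolding ext_basis_def by (rule someI_ex)
qed

sublocale K: finite_dimensional_vector_space "ext_scale \<iota>" ext_basis
  using ext_basis by unfold_locales auto

lemma embedding_zero: "\<iota> 0 = 0"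
  using embedding by (metis add_cancel_left_left field_embedding_def)

text \<open>Taking linear combinations of the basis is a bijection from coefficient families to the
  big field. This identifies \<open>card ext_basis\<close> with \<open>m\<close> in the final
  theorem.\<close>

lemma card_extension: "CARD('a) = CARD('k) ^ card ext_basis"
proof -
  let ?\<Phi> = "\<lambda>f. \<Sum>b\<in>ext_basis. ext_scale \<iota> (f b) b"
  have "bij_betw ?\<Phi> (ext_basis \<rightarrow>\<^sub>E UNIV) UNIV"
    unfolding bij_betw_def
  proof
    show "inj_on ?\<Phi> (ext_basis \<rightarrow>\<^sub>E UNIV)"
    proof (rule inj_onI)
      fix f g assume f: "f \<in> ext_basis \<rightarrow>\<^sub>E UNIV" and g: "g \<in> ext_basis \<rightarrow>\<^sub>E UNIV" and eq: "?\<Phi> f = ?\<Phi> g"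
      have "(\<Sum>b\<in>ext_basis. ext_scale \<iota> (f b - g b) b) = 0"
        using eq by (simp add: K.scale_left_diff_distrib sum_subtractf)
      then have "f b - g b = 0" if "b \<in> ext_basis" for b
        using K.independentD[OF K.independent_Basis K.finite_Basis subset_refl, of "\<lambda>b. f b - g b"] that
        by blast
      then show "f = g" using f g by (intro PiE_ext) auto
    qed
    show "?\<Phi> ` (ext_basis \<rightarrow>\<^sub>E UNIV) = UNIV"
    proof -
      have "x \<in> ?\<Phi> ` (ext_basis \<rightarrow>\<^sub>E UNIV)" for x
      proof -
        obtain f where f: "x = (\<Sum>b\<in>ext_basis. ext_scale \<iota> (f b) b)"
          using K.span_finite[OF K.finite_Basis] K.span_Basis by blast
        then show ?thesis by (intro image_eqI[where x = "restrict f ext_basis"]) simp_all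
      qed
      then show ?thesis by blast
    qed
  qed
  then have "card (ext_basis \<rightarrow>\<^sub>E (UNIV :: 'k set)) = CARD('a)" by (rule bij_betw_same_card)
  then show ?thesis by (simp add: card_PiE K.finite_Basis)
qed

lemma rk_le_if_range_subset:
  assumes "range (($) v) \<subseteq> K.span S"
  shows "rk \<iota> v \<le> card S"
  unfolding rk_def K.dim_span using assms by (rule K.dim_le_card) simp

lemma rk_le_card_support:
  fixes v :: "'a ^ 'n::finite"
  assumes "\<And>j. j \<notin> J \<Longrightarrow> v $ j = 0"
  shows "rk \<iota> v \<le> card J"
proof -
  have "range (($) v) \<subseteq> K.span (($) v ` J)"
    using assms by (auto simp: image_iff) (metis K.span_base K.span_zero imageI)
  then have "rk \<iota> v \<le> card (($) v ` J)" by (rule rk_le_if_range_subset)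
  also have "\<dots> \<le> card J" by (rule card_image_le) simp
  finally show ?thesis .
qed

lemma rk_ge_card_independent:
  assumes "K.independent S" "S \<subseteq> K.span (range (($) v))"
  shows "card S \<le> rk \<iota> v"
  unfolding rk_def using assms by (intro K.independent_card_le_dim)

lemma rk_le_dimension: "rk \<iota> v \<le> card ext_basis"
  by (rule rk_le_if_range_subset) (simp add: K.span_Basis)

text \<open>Multiplication by \<open>c\<close> is linear over the small field, so it carries a basis
  of the span of the entries to a spanning set for the new entries.\<close>

lemma rk_scale_le: "rk \<iota> (c *s v) \<le> rk \<iota> v"
proof -
  obtain B where B: "B \<subseteq> range (($) v)" "range (($) v) \<subseteq> K.span B" "card B = rk \<iota> v"
    unfolding rk_def K.dim_span using K.basis_exists[of "range (($) v)"] by metis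
  interpret mult: Vector_Spaces.linear "ext_scale \<iota>" "ext_scale \<iota>" "(*) c"
    by unfold_locales (auto simp: ext_scale_def algebra_simps)
  have "range (($) (c *s v)) = (*) c ` range (($) v)" by auto
  also have "\<dots> \<subseteq> K.span ((*) c ` B)" unfolding mult.span_image using B(2) by blast
  finally have "rk \<iota> (c *s v) \<le> card ((*) c ` B)" by (rule rk_le_if_range_subset)
  also have "\<dots> \<le> card B" by (rule card_image_le) simp
  finally show ?thesis using B(3) by simp
qed

lemma axis_in_rank_ball:
  assumes "1 \<le> i"
  shows "axis k c \<in> rank_ball \<iota> i"
  using rk_le_card_support[of "{k}" "axis k c"] assms by (auto simp: rank_ball_def axis_def)

lemma span_rank_ball:
  assumes "1 \<le> i"
  shows "vec.span (rank_ball \<iota> i :: ('a ^ 'n::finite) set) = UNIV"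
proof -
  have "cart_basis \<subseteq> (rank_ball \<iota> i :: ('a ^ 'n) set)"
    using axis_in_rank_ball[OF assms] by (auto simp: cart_basis_def)
  then show ?thesis using vec.span_mono[of cart_basis "rank_ball \<iota> i"] by (simp add: span_cart_basis top.extremum_unique)
qed

lemma UNIV_in_rank_metric_lattice:
  assumes "1 \<le> i"
  shows "(UNIV :: ('a ^ 'n::finite) set) \<in> carrier (rank_metric_lattice \<iota> i)"
  using span_in_rank_metric_lattice[of "rank_ball \<iota> i :: ('a ^ 'n) set" \<iota> i] span_rank_ball[OF assms, where 'n='n]
  by simp

subsection \<open>Modular elements\<close>

text \<open>Under this condition the lattice meet is the plain intersection, and the dimension
  formula for sums and intersections of subspaces gives modularity.\<close>

lemma modular_elementI:
  fixes X :: "('a ^ 'n::finite) set"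
  assumes X: "X \<in> carrier (rank_metric_lattice \<iota> i)"
    and *: "\<And>Y. Y \<in> carrier (rank_metric_lattice \<iota> i) \<Longrightarrow> X \<inter> Y \<subseteq> vec.span (X \<inter> Y \<inter> rank_ball \<iota> i)"
  shows "modular_element (rank_metric_lattice \<iota> i) vec.dim X"
  unfolding modular_element_def
proof (intro conjI ballI X)
  fix Y :: "('a ^ 'n) set" assume Y: "Y \<in> carrier (rank_metric_lattice \<iota> i)"
  have s: "vec.subspace X" "vec.subspace Y" using X Y by (auto intro: subspace_rank_metric_lattice)
  have "vec.span (X \<inter> Y \<inter> rank_ball \<iota> i) \<subseteq> X \<inter> Y"
    using s by (intro vec.span_minimal vec.subspace_inter) auto
  then have "vec.span (X \<inter> Y \<inter> rank_ball \<iota> i) = X \<inter> Y" using *[OF Y] by blast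
  then show "vec.dim (X \<sqinter>\<^bsub>rank_metric_lattice \<iota> i\<^esub> Y) + vec.dim (X \<squnion>\<^bsub>rank_metric_lattice \<iota> i\<^esub> Y)
      = vec.dim X + vec.dim Y"
    unfolding meet_rank_metric_lattice[OF X Y] join_rank_metric_lattice[OF X Y]
    using vec.dim_sums_Int[OF s] by simp
qed

lemma modular_element_if_subset_rank_ball:
  fixes X :: "('a ^ 'n::finite) set"
  assumes "X \<in> carrier (rank_metric_lattice \<iota> i)" "X \<subseteq> rank_ball \<iota> i"
  shows "modular_element (rank_metric_lattice \<iota> i) vec.dim X"
proof (rule modular_elementI[OF assms(1)])
  fix Y :: "('a ^ 'n) set"
  have "X \<inter> Y = X \<inter> Y \<inter> rank_ball \<iota> i" using assms(2) by blast
  then show "X \<inter> Y \<subseteq> vec.span (X \<inter> Y \<inter> rank_ball \<iota> i)" using vec.span_superset by metis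
qed

lemma modular_element_UNIV:
  assumes "1 \<le> i"
  shows "modular_element (rank_metric_lattice \<iota> i) vec.dim (UNIV :: ('a ^ 'n::finite) set)"
  using UNIV_in_rank_metric_lattice[OF assms]
  by (rule modular_elementI) (metis carrier_rank_metric_lattice Int_UNIV_left order_refl)

text \<open>For \<open>i = 1\<close> the lattice elements are the subspaces defined over the small field; these are stable
  under applying a linear functional of the extension (here a coordinate with respect to
  \<open>ext_basis\<close>) to each entry.\<close>

definition coord :: "'a \<Rightarrow> 'a ^ 'n::finite \<Rightarrow> 'a ^ 'n" where
  "coord b v = (\<chi> j. \<iota> (K.representation ext_basis (v $ j) b))"

lemma coord_in_rank_ball: "coord b v \<in> rank_ball \<iota> 1"
proof -
  have "range (($) (coord b v)) \<subseteq> K.span {1}"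
    by (auto simp: coord_def K.span_singleton ext_scale_def)
  then have "rk \<iota> (coord b v) \<le> card {1::'a}" by (rule rk_le_if_range_subset)
  then show ?thesis by (simp add: rank_ball_def)
qed

lemma coord_expansion: "v = (\<Sum>b\<in>ext_basis. b *s coord b v)"
proof -
  have "v $ j = (\<Sum>b\<in>ext_basis. b *s coord b v) $ j" for j
    using K.sum_representation_eq[OF K.independent_Basis _ K.finite_Basis subset_refl, of "v $ j"]
    by (simp add: K.span_Basis ext_scale_def coord_def mult.commute)
  then show ?thesis by (simp add: vec_eq_iff)
qed

lemma coord_zero: "coord b 0 = 0"
  by (simp add: vec_eq_iff coord_def K.representation_zero embedding_zero)

lemma coord_add: "coord b (v + w) = coord b v + coord b w"
  using embedding
  by (simp add: vec_eq_iff coord_def K.span_Basis K.representation_add[OF K.independent_Basis] field_embedding_def)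

text \<open>All entries are multiples, by the small field, of one nonzero entry; otherwise two
  entries would be independent.\<close>

lemma rank_one_vector:
  assumes "v \<in> rank_ball \<iota> 1" "v \<noteq> 0"
  obtains c d where "c \<noteq> 0" "v = (\<chi> j. c * \<iota> (d j))"
proof -
  obtain k where k: "v $ k \<noteq> 0" using assms(2) by (auto simp: vec_eq_iff)
  have "\<exists>e. v $ j = v $ k * \<iota> e" for j
  proof (rule ccontr)
    assume "\<not> ?thesis"
    then have j: "v $ j \<notin> K.span {v $ k}"
      by (auto simp: K.span_singleton ext_scale_def mult.commute)
    then have "K.independent {v $ j, v $ k}" "v $ j \<noteq> v $ k"
      using k by (auto simp: K.independent_insert K.span_base)
    then have "2 \<le> rk \<iota> v"
      using rk_ge_card_independent[of "{v $ j, v $ k}" v] by (auto simp: K.span_base)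
    then show False using assms(1) by (simp add: rank_ball_def)
  qed
  then obtain d where "\<And>j. v $ j = v $ k * \<iota> (d j)" by metis
  then have "v = (\<chi> j. v $ k * \<iota> (d j))" unfolding vec_eq_iff vec_lambda_beta by blast
  then show ?thesis using that k by blast
qed

text \<open>By additivity it suffices to treat multiples of rank-one generators, and there
  \<open>coord b\<close> only rescales the generator.\<close>

lemma coord_in_subspace:
  assumes X: "X \<in> carrier (rank_metric_lattice \<iota> 1)" and "v \<in> X"
  shows "coord b v \<in> X"
proof -
  have sX: "vec.subspace X" using X by (rule subspace_rank_metric_lattice)
  have "v \<in> vec.span (X \<inter> rank_ball \<iota> 1)" using assms carrier_rank_metric_lattice by blast
  then show ?thesis
  proof (induction rule: vec.span_induct_alt)
    case base
    show ?case using vec.subspace_0[OF sX] by (simp add: coord_zero)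
  next
    case (step a s y)
    have "coord b (a *s s) \<in> X"
    proof (cases "s = 0")
      case True
      then show ?thesis using vec.subspace_0[OF sX] by (simp add: coord_zero)
    next
      case False
      then obtain c d where c: "c \<noteq> 0" and s: "s = (\<chi> j. c * \<iota> (d j))"
        using rank_one_vector[of s] step by blast
      let ?r = "K.representation ext_basis (a * c) b"
      \<comment> \<open>The small-field factor \<open>e\<close> comes out of the coordinate, so
        every entry of \<open>coord b (a *s s)\<close> has the common factor
        \<open>\<iota> ?r\<close>.\<close>
      have "K.representation ext_basis (a * (c * \<iota> e)) b = e * ?r" for e
        using K.representation_scale[OF K.independent_Basis, of "a * c" e]
        by (simp add: K.span_Basis ext_scale_def mult_ac)
      then have "coord b (a *s s) = (\<iota> ?r / c) *s s"
        using embedding c by (simp add: vec_eq_iff coord_def s field_embedding_def)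
      then show ?thesis using step vec.subspace_scale[OF sX, of s] by simp
    qed
    then show ?case using step vec.subspace_add[OF sX] by (simp add: coord_add)
  qed
qed

text \<open>The coordinate vectors of \<open>v\<close> have rank at most one, stay in both
  \<open>X\<close> and \<open>Y\<close>, and span a space containing \<open>v\<close>.\<close>

lemma modular_element_rank_one:
  fixes X :: "('a ^ 'n::finite) set"
  assumes X: "X \<in> carrier (rank_metric_lattice \<iota> 1)"
  shows "modular_element (rank_metric_lattice \<iota> 1) vec.dim X"
proof (rule modular_elementI[OF X], rule subsetI)
  fix Y :: "('a ^ 'n) set" and v
  assume Y: "Y \<in> carrier (rank_metric_lattice \<iota> 1)" and v: "v \<in> X \<inter> Y"
  have "coord b v \<in> X \<inter> Y \<inter> rank_ball \<iota> 1" for b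
    using coord_in_subspace X Y v coord_in_rank_ball by blast
  then have "(\<Sum>b\<in>ext_basis. b *s coord b v) \<in> vec.span (X \<inter> Y \<inter> rank_ball \<iota> 1)"
    by (intro vec.span_sum vec.span_scale vec.span_base)
  then show "v \<in> vec.span (X \<inter> Y \<inter> rank_ball \<iota> 1)" using coord_expansion[of v] by simp
qed

subsection \<open>Maximal chains\<close>

text \<open>A maximal chain among the elements comparable with \<open>H\<close> contains
  \<open>H\<close>. Any chain extending it then consists of elements comparable with
  \<open>H\<close>, so it is maximal in the whole lattice.\<close>

lemma supersolvable_if_comparable_modular:
  fixes H :: "('a ^ 'n::finite) set"
  assumes H: "H \<in> carrier (rank_metric_lattice \<iota> i)"
    and mod: "\<And>X. X \<in> carrier (rank_metric_lattice \<iota> i) \<Longrightarrow> X \<subseteq> H \<or> H \<subseteq> X \<Longrightarrow>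
      modular_element (rank_metric_lattice \<iota> i) vec.dim X"
  shows "supersolvable (rank_metric_lattice \<iota> i :: ('a ^ 'n) set gorder) vec.dim"
proof -
  let ?L = "rank_metric_lattice \<iota> i :: ('a ^ 'n) set gorder"
  define A where "A = {X \<in> carrier ?L. X \<subseteq> H \<or> H \<subseteq> X}"
  obtain C where C: "pred_on.maxchain A (lless ?L) C"
    using pred_on.Hausdorff by blast
  have CA: "C \<subseteq> A" and Cc: "\<And>X Y. X \<in> C \<Longrightarrow> Y \<in> C \<Longrightarrow> X \<subseteq> Y \<or> Y \<subseteq> X"
    using C by (auto simp: pred_on.maxchain_def chain_rank_metric_lattice)
  have "pred_on.chain A (lless ?L) (insert H C)"
    using CA Cc H unfolding chain_rank_metric_lattice A_def by blast
  then have HC: "H \<in> C" using C by (auto simp: pred_on.maxchain_def)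
  have "pred_on.maxchain (carrier ?L) (lless ?L) C"
    unfolding pred_on.maxchain_def
  proof (intro conjI notI)
    show "pred_on.chain (carrier ?L) (lless ?L) C"
      using CA Cc by (auto simp: chain_rank_metric_lattice A_def)
    assume "\<exists>S. pred_on.chain (carrier ?L) (lless ?L) S \<and> C \<subset> S"
    then obtain S where S: "pred_on.chain (carrier ?L) (lless ?L) S" "C \<subset> S" by blast
    then have "pred_on.chain A (lless ?L) S"
      using HC unfolding chain_rank_metric_lattice A_def by blast
    then show False using C S(2) by (auto simp: pred_on.maxchain_def)
  qed
  moreover have "modular_element ?L vec.dim X" if "X \<in> C" for X
    using mod CA that by (auto simp: A_def)
  ultimately show ?thesis unfolding supersolvable_def by blast
qed

text \<open>Take the largest proper member \<open>H\<close> of the chain and adjoin one vector of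
  the rank ball outside it. The result is comparable with every member, hence in the chain, hence
  the whole space.\<close>

lemma coatom_in_maxchain:
  fixes C :: "('a ^ 'n::finite) set set"
  assumes C: "pred_on.maxchain (carrier (rank_metric_lattice \<iota> i)) (lless (rank_metric_lattice \<iota> i)) C"
    and i: "1 \<le> i"
  obtains H where "H \<in> C" "Suc (vec.dim H) = CARD('n)"
proof -
  let ?L = "rank_metric_lattice \<iota> i :: ('a ^ 'n) set gorder"
  have CL: "C \<subseteq> carrier ?L" and Cc: "\<And>X Y. X \<in> C \<Longrightarrow> Y \<in> C \<Longrightarrow> X \<subseteq> Y \<or> Y \<subseteq> X"
    using C by (auto simp: pred_on.maxchain_def chain_rank_metric_lattice)
  have max: "Z \<in> C" if "Z \<in> carrier ?L" "\<And>X. X \<in> C \<Longrightarrow> X \<subseteq> Z \<or> Z \<subseteq> X" for Z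
  proof -
    have "pred_on.chain (carrier ?L) (lless ?L) (insert Z C)"
      using CL Cc that unfolding chain_rank_metric_lattice by blast
    then show ?thesis using C by (auto simp: pred_on.maxchain_def)
  qed
  have sub: "vec.subspace X" if "X \<in> C" for X using CL that subspace_rank_metric_lattice by blast
  \<comment> \<open>This guarantees that the chain has a proper member.\<close>
  have "{0} \<in> C"
  proof (rule max)
    show "{0} \<in> carrier ?L" using span_in_rank_metric_lattice[of "{}" \<iota> i] by simp
  qed (use sub vec.subspace_0 in blast)
  define D where "D = C - {UNIV}"
  have "axis undefined 1 \<noteq> (0 :: 'a ^ 'n)" by (simp add: axis_eq_0_iff)
  then have "{0} \<noteq> (UNIV :: ('a ^ 'n) set)" by blast
  then have "D \<noteq> {}" using \<open>{0} \<in> C\<close> by (auto simp: D_def)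
  moreover have "finite D" by simp
  moreover have "\<forall>X\<in>D. \<forall>Y\<in>D. X \<subseteq> Y \<or> Y \<subseteq> X" using Cc by (auto simp: D_def)
  ultimately obtain H where H: "H \<in> D" "\<And>X. X \<in> D \<Longrightarrow> X \<subseteq> H"
    using finite_has_maximal[of D] by metis
  then have HC: "H \<in> C" "H \<noteq> UNIV" by (auto simp: D_def)
  have sH: "vec.subspace H" using HC(1) by (rule sub)
  have "\<not> rank_ball \<iota> i \<subseteq> H"
    using HC(2) span_rank_ball[OF i, where 'n='n] vec.span_minimal[OF _ sH] by blast
  then obtain v where v: "v \<in> rank_ball \<iota> i" "v \<notin> H" by blast
  define Z where "Z = vec.span (insert v (H \<inter> rank_ball \<iota> i))"
  have HB: "H = vec.span (H \<inter> rank_ball \<iota> i)" using CL HC(1) carrier_rank_metric_lattice by blast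
  have Z: "Z \<in> carrier ?L" "H \<subseteq> Z" "v \<in> Z"
    unfolding Z_def using v HB vec.span_mono[of "H \<inter> rank_ball \<iota> i" "insert v (H \<inter> rank_ball \<iota> i)"]
    by (auto intro!: span_in_rank_metric_lattice intro: vec.span_base)
  have dimZ: "vec.dim Z = Suc (vec.dim H)"
    unfolding Z_def vec.dim_span vec.dim_insert HB[symmetric]
    using v(2) vec.dim_span[of "H \<inter> rank_ball \<iota> i"] by (simp flip: HB)
  have "Z \<in> C" using H Z by (intro max) (auto simp: D_def)
  then have "Z = UNIV" using H Z v by (auto simp: D_def)
  then have "Suc (vec.dim H) = CARD('n)" using dimZ by (metis vec_dim_card)
  then show ?thesis using that HC(1) by blast
qed

subsection \<open>Obstruction to modular coatoms\<close>

text \<open>The plane spanned by \<open>u\<close> and \<open>v\<close> meets \<open>H\<close> in the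
  line through \<open>u + v\<close>, whose nonzero vectors all have rank above \<open>i\<close>. So
  the lattice meet is zero, while modularity would force it to have positive dimension.\<close>

lemma not_modular_coatomI:
  fixes H :: "('a ^ 'n::finite) set"
  assumes dimH: "Suc (vec.dim H) = CARD('n)"
    and u: "u \<in> rank_ball \<iota> i" "u \<notin> H" and v: "v \<in> rank_ball \<iota> i"
    and uv: "u + v \<in> H" "u + v \<notin> rank_ball \<iota> i"
  shows "\<not> modular_element (rank_metric_lattice \<iota> i) vec.dim H"
proof
  let ?L = "rank_metric_lattice \<iota> i"
  assume mod: "modular_element ?L vec.dim H"
  then have H: "H \<in> carrier ?L" by (simp add: modular_element_def)
  then have sH: "vec.subspace H" by (rule subspace_rank_metric_lattice)
  define Y where "Y = vec.span {u, v}"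
  have Y: "Y \<in> carrier ?L" unfolding Y_def using u v by (intro span_in_rank_metric_lattice) auto
  \<comment> \<open>Subtracting \<open>b *s (u + v)\<close>, which is in \<open>H\<close>, leaves a
    multiple of \<open>u\<close>, which is not in \<open>H\<close> unless it vanishes.\<close>
  have in_H: "a = b" if "a *s u + b *s v \<in> H" for a b
  proof (rule ccontr)
    assume "a \<noteq> b"
    have "a *s u + b *s v - b *s (u + v) \<in> H"
      using that uv(1) sH by (intro vec.subspace_diff vec.subspace_scale)
    moreover have "a *s u + b *s v - b *s (u + v) = (a - b) *s u"
      by (simp add: vec_eq_iff algebra_simps)
    ultimately have "(1 / (a - b)) *s ((a - b) *s u) \<in> H"
      using vec.subspace_scale[OF sH] by metis
    then show False using u(2) \<open>a \<noteq> b\<close> by (simp add: vector_smult_assoc)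
  qed
  have "v \<notin> H"
    using in_H[of 0 1] by auto
  have "u \<notin> vec.span {v}"
  proof
    assume "u \<in> vec.span {v}"
    then obtain c where c: "u = c *s v" by (auto simp: vec.span_singleton)
    then have "1 *s u + (-c) *s v = 0" by (simp add: vec_eq_iff)
    then have "1 = - c" using in_H[of 1 "-c"] vec.subspace_0[OF sH] by simp
    then have "u + v = 0" using c by (metis add.left_inverse minus_equation_iff vec.scale_one vec.scale_minus_left)
    then show False using uv(2) rk_le_card_support[of "{}" "0 :: 'a ^ 'n"] by (simp add: rank_ball_def)
  qed
  then have "vec.dim Y = 2"
    unfolding Y_def vec.dim_span vec.dim_insert[of u] using \<open>v \<notin> H\<close> vec.subspace_0[OF sH] by auto
  moreover have "vec.dim (H \<squnion>\<^bsub>?L\<^esub> Y) \<le> CARD('n)"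
    by (rule dim_subset_UNIV_cart_gen)
  moreover have "vec.dim (H \<sqinter>\<^bsub>?L\<^esub> Y) + vec.dim (H \<squnion>\<^bsub>?L\<^esub> Y) = vec.dim H + vec.dim Y"
    using mod Y by (simp add: modular_element_def)
  \<comment> \<open>With \<open>n = CARD('n)\<close>, the meet has dimension at least
    \<open>(n - 1) + 2 - n = 1\<close>.\<close>
  ultimately have "vec.dim (H \<sqinter>\<^bsub>?L\<^esub> Y) \<noteq> 0" using dimH by linarith
  then have "\<not> H \<inter> Y \<inter> rank_ball \<iota> i \<subseteq> {0}"
    unfolding meet_rank_metric_lattice[OF H Y] vec.dim_span by (simp add: vec.dim_eq_0)
  then obtain z where z: "z \<in> H" "z \<in> Y" "z \<in> rank_ball \<iota> i" "z \<noteq> 0" by blast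
  obtain a b where ab: "z = a *s u + b *s v"
  proof -
    obtain a where "z - a *s u \<in> vec.span {v}" using z(2) vec.span_breakdown_eq[of z u "{v}"] by (auto simp: Y_def)
    then obtain b where "z - a *s u = b *s v" by (auto simp: vec.span_singleton)
    then show ?thesis using that[of a b] by (simp add: algebra_simps)
  qed
  then have "a = b" using z(1) in_H by blast
  then have zb: "z = b *s (u + v)" using ab by (simp add: vector_add_ldistrib)
  then have "b \<noteq> 0" using z(4) by auto
  then have "u + v = (1 / b) *s z" using zb by (simp add: vector_smult_assoc)
  then have "rk \<iota> (u + v) \<le> rk \<iota> z" using rk_scale_le by metis
  then show False using z(3) uv(2) by (simp add: rank_ball_def)
qed

text \<open>Distribute \<open>i + 1\<close> independent values \<open>\<beta> j\<close> over
  positions other than \<open>k\<close>. The vector \<open>u\<close> takes \<open>i\<close> of them,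
  and \<open>v\<close> takes the remaining one; their entries at \<open>k\<close> give the linear
  form opposite nonzero values. As the coefficients come from the small field, entry
  \<open>k\<close> of \<open>u\<close> stays in the span of its other entries.\<close>

lemma not_modular_rational_coatom:
  fixes H :: "('a ^ 'n::finite) set"
  assumes dimH: "Suc (vec.dim H) = CARD('n)"
    and k: "a k = 1" and H: "\<And>x. x \<in> H \<longleftrightarrow> (\<Sum>j\<in>UNIV. x $ j * a j) = 0"
    and rat: "\<And>j. a j \<in> range \<iota>"
    and i: "2 \<le> i" "i + 2 \<le> CARD('n)" "i < card ext_basis"
  shows "\<not> modular_element (rank_metric_lattice \<iota> i) vec.dim H"
proof -
  obtain S where S: "S \<subseteq> ext_basis" "card S = i + 1"
    using obtain_subset_with_card_n[of "i + 1" ext_basis] i(3) by auto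
  have "i + 1 \<le> card (- {k})" using i(2) by (simp add: Compl_eq_Diff_UNIV card_Diff_subset)
  then obtain J where J: "J \<subseteq> - {k}" "card J = i + 1"
    using obtain_subset_with_card_n[of "i + 1" "- {k}"] by auto
  obtain \<beta> where \<beta>: "bij_betw \<beta> J S"
    using finite_same_card_bij[of J S] S J by auto
  obtain j0 where j0: "j0 \<in> J" using J(2) by fastforce
  define J' where "J' = J - {j0}"
  have J': "card J' = i" "J = insert j0 J'" "j0 \<notin> J'" "k \<notin> J'" "k \<noteq> j0"
    using J j0 by (auto simp: J'_def)
  then obtain j1 where j1: "j1 \<in> J'" using i(1) by fastforce
  define \<sigma> where "\<sigma> = (\<Sum>j\<in>J'. \<beta> j * a j)"
  \<comment> \<open>Since \<open>a k = 1\<close>, entry \<open>k\<close> cancels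
    \<open>\<sigma>\<close> and leaves \<open>\<beta> j1\<close> as the value of the form.\<close>
  define u :: "'a ^ 'n" where
    "u = (\<chi> j. if j = k then \<beta> j1 - \<sigma> else if j \<in> J' then \<beta> j else 0)"
  \<comment> \<open>Entry \<open>k\<close> makes the form equal to \<open>- \<beta> j1\<close>; the
    support has two elements, which is where \<open>2 \<le> i\<close> enters.\<close>
  define v :: "'a ^ 'n" where
    "v = (\<chi> j. if j = k then - \<beta> j1 - \<beta> j0 * a j0 else if j = j0 then \<beta> j0 else 0)"
  have u_sum: "(\<Sum>j\<in>UNIV. u $ j * a j) = \<beta> j1"
  proof -
    have "(\<Sum>j\<in>UNIV. u $ j * a j) = (\<Sum>j\<in>insert k J'. u $ j * a j)"
      by (rule sum_support) (auto simp: u_def)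
    also have "\<dots> = (\<beta> j1 - \<sigma>) + (\<Sum>j\<in>J'. u $ j * a j)"
      using J' k by (simp add: u_def)
    also have "(\<Sum>j\<in>J'. u $ j * a j) = \<sigma>"
      unfolding \<sigma>_def using J' by (intro sum.cong) (auto simp: u_def)
    finally show ?thesis by simp
  qed
  have v_sum: "(\<Sum>j\<in>UNIV. v $ j * a j) = - \<beta> j1"
  proof -
    have "(\<Sum>j\<in>UNIV. v $ j * a j) = (\<Sum>j\<in>{k, j0}. v $ j * a j)"
      by (rule sum_support) (auto simp: v_def)
    then show ?thesis using J' k by (simp add: v_def)
  qed
  have indS: "K.independent S" using S(1) K.independent_Basis K.independent_mono by blast
  have "\<beta> j1 \<in> S" using \<beta> j1 J'(2) by (auto simp: bij_betw_def)
  then have "\<beta> j1 \<noteq> 0" using indS K.dependent_zero by metis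
  have \<beta>_span: "\<beta> j \<in> K.span (\<beta> ` J')" if "j \<in> J'" for j using that by (simp add: K.span_base)
  have "\<beta> j * a j \<in> K.span (\<beta> ` J')" if "j \<in> J'" for j
  proof -
    obtain c where "a j = \<iota> c" using rat by blast
    then show ?thesis using K.span_scale[OF \<beta>_span[OF that], of c] by (simp add: ext_scale_def mult.commute)
  qed
  then have "\<sigma> \<in> K.span (\<beta> ` J')" unfolding \<sigma>_def by (rule K.span_sum)
  then have "range (($) u) \<subseteq> K.span (\<beta> ` J')"
    using \<beta>_span j1 by (auto simp: u_def K.span_zero intro!: K.span_diff)
  then have "rk \<iota> u \<le> card (\<beta> ` J')" by (rule rk_le_if_range_subset)
  also have "\<dots> \<le> i" using J'(1) card_image_le[of J' \<beta>] by simp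
  finally have u: "u \<in> rank_ball \<iota> i" by (simp add: rank_ball_def)
  have "rk \<iota> v \<le> card {k, j0}" by (rule rk_le_card_support) (auto simp: v_def)
  then have v: "v \<in> rank_ball \<iota> i" using i(1) J'(5) by (simp add: rank_ball_def)
  have "S \<subseteq> range (($) (u + v))"
  proof
    fix s assume "s \<in> S"
    then obtain j where "j \<in> J" "s = \<beta> j" using \<beta> by (auto simp: bij_betw_def)
    then have "(u + v) $ j = s" using J' by (auto simp: u_def v_def)
    then show "s \<in> range (($) (u + v))" by blast
  qed
  then have "i + 1 \<le> rk \<iota> (u + v)"
    using rk_ge_card_independent[OF indS, of "u + v"] S(2) K.span_superset by fastforce
  then have "u + v \<notin> rank_ball \<iota> i" by (simp add: rank_ball_def)
  moreover have "u \<notin> H" "u + v \<in> H"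
    using \<open>\<beta> j1 \<noteq> 0\<close> u_sum v_sum by (simp_all add: H distrib_right sum.distrib)
  ultimately show ?thesis using not_modular_coatomI[OF dimH u _ v] by blast
qed

text \<open>Here \<open>v\<close> has \<open>i\<close> entries away from \<open>k\<close> whose span
  contains an independent set \<open>S\<close> of size \<open>i\<close>, chosen so that the form
  takes a value \<open>\<sigma>\<close> on \<open>v\<close> outside the span of \<open>S\<close>.
  Correcting entry \<open>k\<close> by \<open>- \<sigma>\<close>, a vector \<open>u\<close> of rank
  one, moves \<open>v\<close> into \<open>H\<close> and raises the rank to
  \<open>i + 1\<close>.\<close>

lemma not_modular_irrational_coatom:
  fixes H :: "('a ^ 'n::finite) set"
  assumes dimH: "Suc (vec.dim H) = CARD('n)"
    and k: "a k = 1" and H: "\<And>x. x \<in> H \<longleftrightarrow> (\<Sum>j\<in>UNIV. x $ j * a j) = 0"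
    and irr: "a l \<notin> range \<iota>"
    and i: "2 \<le> i" "i < CARD('n)" "i < card ext_basis"
  shows "\<not> modular_element (rank_metric_lattice \<iota> i) vec.dim H"
proof -
  have "l \<noteq> k" using irr k embedding by (metis field_embedding_def rangeI)
  have al: "a l \<notin> K.span {1}" using irr by (auto simp: K.span_singleton ext_scale_def)
  then have "K.independent {a l, 1}" "a l \<noteq> 1"
    by (auto simp: K.independent_insert K.span_base)
  \<comment> \<open>The basis contains both elements so that \<open>S\<close> can include
    \<open>1\<close> while \<open>a l\<close> stays outside its span.\<close>
  then obtain B where B: "{a l, 1} \<subseteq> B" "K.independent B" "UNIV \<subseteq> K.span B"
    using K.maximal_independent_subset_extend[OF subset_UNIV] by metis
  have "card B = card ext_basis"
    using K.basis_card_eq_dim[of B UNIV] B by simp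
  then have "i - 1 \<le> card (B - {a l, 1})" using i(3) B(1) \<open>a l \<noteq> 1\<close> by (simp add: card_Diff_subset)
  then obtain S' where S': "S' \<subseteq> B - {a l, 1}" "card S' = i - 1"
    using obtain_subset_with_card_n by metis
  define S where "S = insert 1 S'"
  have indS: "K.independent S"
    using B S' unfolding S_def by (intro K.independent_mono[OF B(2)]) auto
  have cardS: "card S = i" using S' i(1) by (subst S_def, subst card_insert_disjoint) auto
  have alS: "a l \<notin> K.span S"
  proof
    assume "a l \<in> K.span S"
    then have "a l \<in> K.span (B - {a l})"
      using K.span_mono[of S "B - {a l}"] S' B(1) \<open>a l \<noteq> 1\<close> by (auto simp: S_def)
    then show False using B by (auto simp: K.dependent_def)
  qed
  have "i - 1 \<le> card (- {k, l})" using i(2) \<open>l \<noteq> k\<close> by (simp add: Compl_eq_Diff_UNIV card_Diff_subset)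
  then obtain J1 where J1: "J1 \<subseteq> - {k, l}" "card J1 = i - 1"
    using obtain_subset_with_card_n by metis
  then obtain l' where l': "l' \<in> J1" using i(1) by fastforce
  \<comment> \<open>Position \<open>l\<close> must belong to \<open>J\<close>, since changing the
    entry there by \<open>1\<close> shifts the form by \<open>a l\<close>; the separate position
    \<open>l'\<close> will hold the value \<open>1\<close>.\<close>
  define J' where "J' = insert l (J1 - {l'})"
  define J where "J = insert l' J'"
  have J: "l' \<notin> J'" "l \<noteq> l'" "l \<in> J" "k \<notin> J"
    using J1 l' \<open>l \<noteq> k\<close> by (auto simp: J_def J'_def)
  have "l \<notin> J1" using J1 by blast
  then have cardJ': "card J' = i - 1"
    using J1(2) l' i(1) by (simp add: J'_def)
  have "card J = i" unfolding J_def using J(1) cardJ' i(1) by simp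
  obtain \<gamma> where \<gamma>: "bij_betw \<gamma> J' S'"
    using finite_same_card_bij[of J' S'] S' cardJ' by auto
  define \<beta> where "\<beta> = \<gamma>(l' := 1)"
  have \<beta>: "\<beta> ` J = S" "\<beta> l' = 1"
    using \<gamma> J(1) by (auto simp: \<beta>_def J_def S_def bij_betw_def)
  define \<beta>' where "\<beta>' = \<beta>(l := \<beta> l + 1)"
  have "(\<Sum>j\<in>J. \<beta>' j * a j) = (\<Sum>j\<in>J. \<beta> j * a j) + a l"
  proof -
    have "(\<Sum>j\<in>J. \<beta>' j * a j) = (\<Sum>j\<in>J. \<beta> j * a j + (if j = l then a l else 0))"
      by (intro sum.cong) (auto simp: \<beta>'_def distrib_right)
    then show ?thesis using J by (simp add: sum.distrib)
  qed
  then have "(\<Sum>j\<in>J. \<beta> j * a j) \<notin> K.span S \<or> (\<Sum>j\<in>J. \<beta>' j * a j) \<notin> K.span S"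
    using alS K.span_diff[of "\<Sum>j\<in>J. \<beta>' j * a j" S "\<Sum>j\<in>J. \<beta> j * a j"] by auto
  moreover have "S \<subseteq> K.span (\<beta> ` J)" using \<beta> K.span_superset by auto
  moreover have "S \<subseteq> K.span (\<beta>' ` J)"
  proof
    fix s assume "s \<in> S"
    then obtain j where j: "j \<in> J" "s = \<beta> j" using \<beta> by auto
    have *: "\<beta>' j \<in> K.span (\<beta>' ` J)" "\<beta>' l' \<in> K.span (\<beta>' ` J)"
      using j by (auto intro!: K.span_base simp: J_def)
    have "\<beta>' l' = 1" using \<beta> J by (simp add: \<beta>'_def)
    \<comment> \<open>At position \<open>l\<close> the original value is recovered as
      \<open>\<beta>' l - \<beta>' l'\<close>.\<close>
    then show "s \<in> K.span (\<beta>' ` J)"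
      using j * K.span_diff[OF *] by (cases "j = l") (auto simp: \<beta>'_def)
  qed
  \<comment> \<open>Replacing \<open>\<beta>\<close> by \<open>\<beta>'\<close> keeps the span but shifts the sum by \<open>a l\<close>, which lies outside the span.\<close>
  ultimately obtain \<delta> where \<delta>: "(\<Sum>j\<in>J. \<delta> j * a j) \<notin> K.span S" "S \<subseteq> K.span (\<delta> ` J)"
    by blast
  define \<sigma> where "\<sigma> = (\<Sum>j\<in>J. \<delta> j * a j)"
  define u :: "'a ^ 'n" where "u = axis k (- \<sigma>)"
  define v :: "'a ^ 'n" where "v = (\<chi> j. if j \<in> J then \<delta> j else 0)"
  have \<sigma>0: "\<sigma> \<noteq> 0" using \<delta>(1) K.span_zero \<sigma>_def by metis
  have u_sum: "(\<Sum>j\<in>UNIV. u $ j * a j) = - \<sigma>"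
    using sum_support[of "{k}" "\<lambda>j. u $ j * a j"] k by (auto simp: u_def axis_def)
  have "(\<Sum>j\<in>UNIV. v $ j * a j) = (\<Sum>j\<in>J. v $ j * a j)"
    by (rule sum_support) (auto simp: v_def)
  also have "\<dots> = \<sigma>" unfolding \<sigma>_def by (intro sum.cong) (auto simp: v_def)
  finally have v_sum: "(\<Sum>j\<in>UNIV. v $ j * a j) = \<sigma>" .
  have u: "u \<in> rank_ball \<iota> i" unfolding u_def using i(1) by (intro axis_in_rank_ball) simp
  have "rk \<iota> v \<le> card J" by (rule rk_le_card_support) (auto simp: v_def)
  then have v: "v \<in> rank_ball \<iota> i" using \<open>card J = i\<close> by (simp add: rank_ball_def)
  let ?W = "K.span (range (($) (u + v)))"
  have "\<delta> ` J \<subseteq> range (($) (u + v))"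
  proof
    fix s assume "s \<in> \<delta> ` J"
    then obtain j where "j \<in> J" "s = \<delta> j" by auto
    then have "(u + v) $ j = s" using J(4) by (auto simp: u_def v_def axis_def)
    then show "s \<in> range (($) (u + v))" by blast
  qed
  then have "S \<subseteq> ?W" using \<delta>(2) K.span_mono by blast
  moreover have "- \<sigma> \<in> ?W"
  proof -
    have "(u + v) $ k = - \<sigma>" using J(4) by (simp add: u_def v_def axis_def)
    then show ?thesis by (metis K.span_base rangeI)
  qed
  ultimately have "insert (- \<sigma>) S \<subseteq> ?W" by blast
  moreover have n\<sigma>: "- \<sigma> \<notin> K.span S" using \<delta>(1) K.span_neg[of "- \<sigma>" S] by (auto simp: \<sigma>_def)
  ultimately have "card (insert (- \<sigma>) S) \<le> rk \<iota> (u + v)"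
    using indS by (intro rk_ge_card_independent K.independent_insertI) auto
  moreover have "card (insert (- \<sigma>) S) = i + 1" using n\<sigma> K.span_base[of "- \<sigma>" S] cardS by (subst card_insert_disjoint) auto
  ultimately have "u + v \<notin> rank_ball \<iota> i" by (simp add: rank_ball_def)
  moreover have "u \<notin> H" "u + v \<in> H"
    using \<sigma>0 u_sum v_sum by (simp_all add: H distrib_right sum.distrib)
  ultimately show ?thesis using not_modular_coatomI[OF dimH u _ v] by blast
qed

section \<open>Failure of supersolvability, and the cases where it holds\<close>

lemma not_supersolvable:
  assumes i: "2 \<le> i" "i + 2 \<le> CARD('n)" "i < card ext_basis"
  shows "\<not> supersolvable (rank_metric_lattice \<iota> i :: ('a ^ 'n::finite) set gorder) vec.dim"
proof
  let ?L = "rank_metric_lattice \<iota> i :: ('a ^ 'n) set gorder"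
  assume "supersolvable ?L vec.dim"
  then obtain C where C: "pred_on.maxchain (carrier ?L) (lless ?L) C"
    and mod: "\<And>X. X \<in> C \<Longrightarrow> modular_element ?L vec.dim X"
    unfolding supersolvable_def by blast
  obtain H where H: "H \<in> C" "Suc (vec.dim H) = CARD('n)"
    using coatom_in_maxchain[OF C] i(1) by auto
  have "vec.subspace H"
    using mod[OF H(1)] subspace_rank_metric_lattice by (auto simp: modular_element_def)
  then obtain k a where ka: "a k = 1" "\<And>x. x \<in> H \<longleftrightarrow> (\<Sum>j\<in>UNIV. x $ j * a j) = 0"
    using hyperplane_equation H(2) by metis
  show False
  proof (cases "\<forall>j. a j \<in> range \<iota>")
    case True
    then show False
      using not_modular_rational_coatom[of H a k i] H ka i mod by blast
  next
    case False
    then obtain l where "a l \<notin> range \<iota>" by blast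
    then show False
      using not_modular_irrational_coatom[of H a k l i] H ka i mod by simp
  qed
qed

text \<open>This covers both \<open>i = n\<close> and \<open>m \<le> i\<close>.\<close>

lemma supersolvable_if_rank_ball_UNIV:
  assumes "(rank_ball \<iota> i :: ('a ^ 'n::finite) set) = UNIV"
  shows "supersolvable (rank_metric_lattice \<iota> i :: ('a ^ 'n) set gorder) vec.dim"
  using assms by (intro supersolvable_if_all_modular modular_element_if_subset_rank_ball) auto

text \<open>Vectors in a coordinate hyperplane have at most \<open>n - 1\<close> nonzero entries, so
  the hyperplane lies in the rank ball and everything inside it is modular. The only element
  strictly above it is the whole space.\<close>

lemma supersolvable_pred:
  assumes n: "2 \<le> CARD('n)"
  shows "supersolvable (rank_metric_lattice \<iota> (CARD('n) - 1) :: ('a ^ 'n::finite) set gorder) vec.dim"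
proof -
  let ?i = "CARD('n) - 1"
  fix k :: 'n
  \<comment> \<open>The condition is phrased through \<open>- {k}\<close> to match
    \<open>dim_substandard_cart\<close>.\<close>
  define H where "H = {x :: 'a ^ 'n. \<forall>j. j \<notin> - {k} \<longrightarrow> x $ j = 0}"
  have dimH: "vec.dim H = ?i"
    unfolding H_def dim_substandard_cart by (simp add: Compl_eq_Diff_UNIV card_Diff_subset)
  have sH: "vec.subspace H" by (auto simp: H_def vec.subspace_def)
  have HB: "H \<subseteq> rank_ball \<iota> ?i"
  proof
    fix x assume "x \<in> H"
    then have "rk \<iota> x \<le> card (- {k})" by (intro rk_le_card_support) (auto simp: H_def)
    then show "x \<in> rank_ball \<iota> ?i" by (simp add: rank_ball_def Compl_eq_Diff_UNIV card_Diff_subset)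
  qed
  then have "H \<in> carrier (rank_metric_lattice \<iota> ?i)"
    using span_in_rank_metric_lattice[OF HB] unfolding vec.span_eq_iff[THEN iffD2, OF sH] by blast
  then show ?thesis
  proof (rule supersolvable_if_comparable_modular)
    fix X assume X: "X \<in> carrier (rank_metric_lattice \<iota> ?i)" "X \<subseteq> H \<or> H \<subseteq> X"
    show "modular_element (rank_metric_lattice \<iota> ?i) vec.dim X"
    proof (cases "X \<subseteq> H")
      case True
      then show ?thesis using X(1) HB by (intro modular_element_if_subset_rank_ball) auto
    next
      case False
      have sX: "vec.subspace X" using X(1) by (rule subspace_rank_metric_lattice)
      have "H \<subset> X" using X False by blast
      then have "vec.dim H < vec.dim X"
        using sH sX vec.dim_psubset by (metis vec.span_eq_iff)
      then have "vec.dim X \<ge> CARD('n)" using dimH by simp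
      then have "vec.dim X = CARD('n)" using dim_subset_UNIV_cart_gen[of X] by simp
      then have "X = UNIV"
        using sX vec.dim_eq_full[of X] vec_dim_card vec.span_eq_iff by (metis vec.dimension_def vec.dim_UNIV)
      moreover have "1 \<le> ?i" using n by simp
      ultimately show ?thesis using modular_element_UNIV by blast
    qed
  qed
qed

end

theorem theorem3p2:
  fixes \<iota> :: "'k::{field, finite} \<Rightarrow> 'a::{field, finite}" and q n m i :: nat
  assumes "field_embedding \<iota>"
    and "CARD('k) = q" and "CARD('a) = q ^ m" and "CARD('n::finite) = n"
    and "n \<ge> 2" and "m \<ge> 2" and "i \<in> {1..n}"
  shows "supersolvable (rank_metric_lattice \<iota> i :: ('a ^ 'n) set gorder) vec.dim
    \<longleftrightarrow> i \<in> {1, n - 1, n} \<or> m \<in> {2..i}"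
proof -
  interpret finite_field_extension \<iota> by unfold_locales fact
  let ?L = "rank_metric_lattice \<iota> i :: ('a ^ 'n) set gorder"
  have "card {0, 1 :: 'k} \<le> CARD('k)" by (rule card_mono) auto
  \<comment> \<open>With base above one, equality of the powers \<open>q ^ m\<close> and
    \<open>q ^ card ext_basis\<close> gives equality of the exponents.\<close>
  then have "1 < q" using assms(2) by simp
  then have m: "card ext_basis = m"
    using card_extension assms(2,3) by simp
  show ?thesis
  proof
    assume "supersolvable ?L vec.dim"
    \<comment> \<open>Given \<open>1 \<le> i \<le> n\<close> and \<open>2 \<le> m\<close>, the
      failure of the three conditions means \<open>i = 1\<close>, \<open>i \<in> {n - 1, n}\<close>
      or \<open>m \<in> {2..i}\<close> respectively.\<close>
    then have "\<not> (2 \<le> i \<and> i + 2 \<le> CARD('n) \<and> i < card ext_basis)"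
      using not_supersolvable[of i] by blast
    then show "i \<in> {1, n - 1, n} \<or> m \<in> {2..i}" using assms m by auto
  next
    assume "i \<in> {1, n - 1, n} \<or> m \<in> {2..i}"
    then consider "i = 1" | "i = n - 1" | "i = n" | "m \<le> i" by auto
    then show "supersolvable ?L vec.dim"
    proof cases
      case 1
      then show ?thesis using modular_element_rank_one by (intro supersolvable_if_all_modular) auto
    next
      case 2
      then show ?thesis using supersolvable_pred assms by blast
    next
      case 3
      have "rk \<iota> v \<le> CARD('n)" for v :: "'a ^ 'n" by (rule rk_le_card_support) auto
      then show ?thesis
        using 3 assms(4) by (intro supersolvable_if_rank_ball_UNIV) (auto simp: rank_ball_def)
    next
      case 4
      then show ?thesis
        using m rk_le_dimension order_trans by (intro supersolvable_if_rank_ball_UNIV) (auto simp: rank_ball_def)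
    qed
  qed
qed

end
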